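(* For every integer $r\ge 4$, one has $$n_0(r)\ \ge\ 2r+2 .$$
   Context: For a positive integer $n$ write $[n]=\{1,\dots,n\}$. For a family $\mathcal F\subseteq 2^{[n]}$ write $S(\mathcal F)=\{|A| : A\in\mathcal F\}$ and $\mathcal F_t=\{A\in\mathcal F : |A|=t\}$ for $t=0,1,\dots,n$. Given an integer $r\ge 1$, $\mathcal F$ is called an $r$-multiplicity antichain if (i) $A\not\subseteq B$ for all distinct $A,B\in\mathcal F$, and (ii) $|\mathcal F_t|\ge r$ for every $t\in S(\mathcal F)$. For integers $n,r\ge 1$ define $$g(n,r)=\max\{|S(\mathcal F)| : \mathcal F\subseteq 2^{[n]} \text{ is an } r\text{-multiplicity antichain}\}.$$ For an integer $r\ge 2$, $n_0(r)$ denotes the smallest integer $n_0$ such that $g(n,r)=n-3$ for every integer $n>n_0$. *)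

theory Defs
  imports Main
begin

definition sizes :: "'a set set \<Rightarrow> nat set" where
  "sizes \<F> = card ` \<F>"

definition level :: "'a set set \<Rightarrow> nat \<Rightarrow> 'a set set" where
  "level \<F> t = {A \<in> \<F>. card A = t}"

definition multiplicity_antichain :: "nat \<Rightarrow> 'a set set \<Rightarrow> bool" where
  "multiplicity_antichain r \<F> \<longleftrightarrow>
     (\<forall>A\<in>\<F>. \<forall>B\<in>\<F>. A \<noteq> B \<longrightarrow> \<not> A \<subseteq> B) \<and>
     (\<forall>t\<in>sizes \<F>. r \<le> card (level \<F> t))"

(* The empty family is admissible, so the maximum is over a nonempty finite set. *)
definition g :: "nat \<Rightarrow> nat \<Rightarrow> nat" where
  "g n r = Max {card (sizes \<F>) | \<F>. \<F> \<subseteq> Pow {1..n} \<and> multiplicity_antichain r \<F>}"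

(* The difference n - 3 is taken in the integers, since truncated subtraction would make the
   equation hold spuriously for small n.  As g 1 r \<ge> 0 > 1 - 3, the equation fails at n = 1,
   so the least integer with this property is positive and nothing is lost by letting
   m range over the natural numbers only. *)
definition n0 :: "nat \<Rightarrow> nat" where
  "n0 r = (LEAST m. \<forall>n>m. int (g n r) = int n - 3)"

end

theory Submission
  imports Defs
begin

text \<open>
  For \<open>r \<ge> 4\<close> and \<open>n \<ge> 5\<close>, an \<open>r\<close>-multiplicity antichain with a size outside \<open>{2..n-2}\<close> has
  fewer than \<open>n - 3\<close> sizes, because \<open>r\<close> singletons (or, dually, \<open>r\<close> co-singletons) confine all
  other members. So \<open>g n r \<le> n - 3\<close>, with equality only if the sizes are exactly \<open>{2..n-2}\<close>.

  Let \<open>n = 2r + 2\<close> and suppose that all these sizes occur. The members of size 2 and the complements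
  of the members of size \<open>n - 2\<close> are cross-intersecting pairs, hence they form two stars with a common
  centre \<open>x\<close>. A member through \<open>x\<close> avoids the \<open>r\<close> leaves of the first star, and a member missing \<open>x\<close>
  contains the \<open>r\<close> leaves of the second. So the members of size \<open>3\<close> and \<open>r\<close> all pass through \<open>x\<close> and
  live on \<open>r + 1\<close> further points; the same star argument there leaves room for a single member
  of size \<open>r + 1\<close> through \<open>x\<close>, and by duality for a single one missing \<open>x\<close>.

  The minimum defining \<open>n0 r\<close> is attained because \<open>g n r = n - 3\<close> for large \<open>n\<close>: padding distinct
  pairs of a small pool with points outside the pool gives an antichain with small sizes.
  Adjoining a new point \<open>n\<close> to its members gives the lower half of the sizes, and the
  complements in \<open>{1..n-1}\<close> of such members give the upper half.
\<close>

section \<open>Cross-intersecting families of pairs\<close>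

lemma card_2_subset_eq:
  assumes "card A = 2" "a \<in> A" "b \<in> A" "a \<noteq> b"
  shows "A = {a, b}"
  using assms by (auto simp: card_2_iff)

text \<open>If \<open>A\<close> and \<open>B\<close> were disjoint, every member of \<open>H\<close>
  would take one point from each, so \<open>H\<close> would consist of all four such transversals.
  Only \<open>A\<close> and \<open>B\<close> meet all of these, which leaves \<open>G\<close> too
  few members.\<close>

lemma pairs_intersecting_of_cross:
  assumes G2: "\<And>A. A \<in> G \<Longrightarrow> card A = 2" and H2: "\<And>B. B \<in> H \<Longrightarrow> card B = 2"
    and cG: "4 \<le> card G" and cH: "4 \<le> card H"
    and cross: "\<And>A B. A \<in> G \<Longrightarrow> B \<in> H \<Longrightarrow> A \<inter> B \<noteq> {}"
    and AB: "A \<in> G" "B \<in> G"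
  shows "A \<inter> B \<noteq> {}"
proof
  assume disj: "A \<inter> B = {}"
  obtain a b where A: "A = {a, b}" "a \<noteq> b" using G2[OF AB(1)] by (auto simp: card_2_iff)
  obtain c d where B: "B = {c, d}" "c \<noteq> d" using G2[OF AB(2)] by (auto simp: card_2_iff)
  define K where "K = {{a, c}, {a, d}, {b, c}, {b, d}}"
  have "H \<subseteq> K"
  proof
    fix C assume C: "C \<in> H"
    obtain p where p: "p \<in> A" "p \<in> C" using cross[OF AB(1) C] by auto
    obtain q where q: "q \<in> B" "q \<in> C" using cross[OF AB(2) C] by auto
    have "C = {p, q}" using p q disj H2[OF C] by (intro card_2_subset_eq) auto
    thus "C \<in> K" using p(1) q(1) A B unfolding K_def by auto
  qed
  moreover have "card K \<le> 4"
    using card_length[of "[{a, c}, {a, d}, {b, c}, {b, d}]"] by (simp add: K_def)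
  moreover have "finite K" unfolding K_def by simp
  ultimately have "H = K" using cH by (meson card_seteq le_trans)
  have "G \<subseteq> {A, B}"
  proof
    fix C assume C: "C \<in> G"
    \<comment> \<open>The four transversals form a 4-cycle, so a set missing \<open>a\<close> or
      \<open>b\<close> has to contain both \<open>c\<close> and \<open>d\<close>.\<close>
    have m: "C \<inter> {a, c} \<noteq> {}" "C \<inter> {a, d} \<noteq> {}" "C \<inter> {b, c} \<noteq> {}" "C \<inter> {b, d} \<noteq> {}"
      using cross[OF C] unfolding \<open>H = K\<close> K_def by blast+
    show "C \<in> {A, B}"
    proof (cases "a \<in> C \<and> b \<in> C")
      case True
      then show ?thesis using card_2_subset_eq[OF G2[OF C], of a b] A by auto
    next
      case False
      then have "c \<in> C" "d \<in> C" using m by auto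
      then show ?thesis using card_2_subset_eq[OF G2[OF C], of c d] B by auto
    qed
  qed
  hence "card G \<le> card {A, B}" by (intro card_mono) auto
  also have "\<dots> \<le> 2" by (simp add: card_insert_if)
  finally show False using cG by simp
qed

lemma not_three_in_pair:
  assumes "card C = 2" "b \<in> C" "c \<in> C" "d \<in> C" "b \<noteq> c" "b \<noteq> d" "c \<noteq> d"
  shows False
  using assms by (auto simp: card_2_iff)

text \<open>By the previous lemma \<open>G\<close> is intersecting, hence a star or a triangle, and
  four members rule out the triangle. Three members of \<open>G\<close> then share a point
  \<open>a\<close> and have distinct leaves, and a pair that meets all three but misses
  \<open>a\<close> would have to contain all three leaves.\<close>

lemma cross_intersecting_pairs_star:
  assumes G2: "\<And>A. A \<in> G \<Longrightarrow> card A = 2" and H2: "\<And>B. B \<in> H \<Longrightarrow> card B = 2"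
    and cG: "4 \<le> card G" and cH: "4 \<le> card H"
    and cross: "\<And>A B. A \<in> G \<Longrightarrow> B \<in> H \<Longrightarrow> A \<inter> B \<noteq> {}"
  shows "\<exists>x. \<forall>A\<in>G \<union> H. x \<in> A"
proof -
  have int: "A \<inter> B \<noteq> {}" if "A \<in> G" "B \<in> G" for A B
    using pairs_intersecting_of_cross[OF G2 H2 cG cH cross that] .
  have more: "\<exists>D\<in>G. D \<notin> T" if "finite T" "card T \<le> 3" for T
  proof (rule ccontr)
    assume "\<not> (\<exists>D\<in>G. D \<notin> T)"
    hence "card G \<le> card T" using that by (intro card_mono) auto
    thus False using that cG by simp
  qed
  obtain A where A: "A \<in> G" using more[of "{}"] by auto
  obtain B where B: "B \<in> G" "B \<noteq> A" using more[of "{A}"] by auto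
  obtain a where a: "a \<in> A" "a \<in> B" using int[OF A B(1)] by auto
  obtain b where b: "b \<in> A" "b \<noteq> a" using G2[OF A] by (auto simp: card_2_iff)
  obtain c where c: "c \<in> B" "c \<noteq> a" using G2[OF B(1)] by (auto simp: card_2_iff)
  have Ae: "A = {a, b}" using card_2_subset_eq[OF G2[OF A]] a b by auto
  have Be: "B = {a, c}" using card_2_subset_eq[OF G2[OF B(1)]] a c by auto
  have bc: "b \<noteq> c" using Ae Be B by auto
  \<comment> \<open>Excluding \<open>{b, c}\<close>, the third edge of the triangle spanned by
    \<open>A\<close> and \<open>B\<close>, is what forces \<open>D\<close> through
    \<open>a\<close>.\<close>
  obtain D where D: "D \<in> G" "D \<notin> {A, B, {b, c}}"
    using more[of "{A, B, {b, c}}"] card_length[of "[A, B, {b, c}]"] by auto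
  have "a \<in> D"
  proof (rule ccontr)
    assume "a \<notin> D"
    hence "b \<in> D" "c \<in> D" using int[OF A D(1)] int[OF B(1) D(1)] Ae Be by auto
    hence "D = {b, c}" using card_2_subset_eq[OF G2[OF D(1)]] bc by blast
    thus False using D by auto
  qed
  then obtain d where d: "d \<in> D" "d \<noteq> a" using G2[OF D(1)] by (auto simp: card_2_iff)
  have De: "D = {a, d}" using card_2_subset_eq[OF G2[OF D(1)] \<open>a \<in> D\<close> d(1)] d by auto
  have dbc: "b \<noteq> d" "c \<noteq> d" using D De Ae Be by auto
  have centre: "a \<in> C" if "card C = 2" "A \<inter> C \<noteq> {}" "B \<inter> C \<noteq> {}" "D \<inter> C \<noteq> {}" for C
  proof (rule ccontr)
    assume "a \<notin> C"
    hence "b \<in> C" "c \<in> C" "d \<in> C" using that Ae Be De by auto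
    thus False using not_three_in_pair that(1) bc dbc by metis
  qed
  have "a \<in> C" if "C \<in> G" for C using that by (intro centre G2 int A B(1) D(1))
  moreover have "a \<in> C" if "C \<in> H" for C using that by (intro centre H2 cross A B(1) D(1))
  ultimately show ?thesis by blast
qed

section \<open>Multiplicity antichains and their complementary families\<close>

lemma multiplicity_antichainD:
  assumes "multiplicity_antichain r F"
  shows "\<And>A B. A \<in> F \<Longrightarrow> B \<in> F \<Longrightarrow> A \<subseteq> B \<Longrightarrow> A = B"
    and "\<And>t. t \<in> sizes F \<Longrightarrow> r \<le> card (level F t)"
  using assms unfolding multiplicity_antichain_def by blast+

definition cofamily :: "'a set \<Rightarrow> 'a set set \<Rightarrow> 'a set set" where
  "cofamily V F = (\<lambda>A. V - A) ` F"

lemma cofamily_subset: "cofamily V F \<subseteq> Pow V"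
  by (auto simp: cofamily_def)

lemma inj_on_Diff_Pow: "inj_on (\<lambda>A. V - A) (Pow V)"
  by (rule inj_onI) blast

lemma level_cofamily:
  assumes "F \<subseteq> Pow V" "finite V" "t \<le> card V"
  shows "level (cofamily V F) t = (\<lambda>A. V - A) ` level F (card V - t)"
proof -
  have "card (V - A) = t \<longleftrightarrow> card A = card V - t" if "A \<in> F" for A
    using that assms card_mono[of V A] by (auto simp: card_Diff_subset finite_subset)
  thus ?thesis unfolding level_def cofamily_def by auto
qed

lemma card_level_cofamily:
  assumes "F \<subseteq> Pow V" "finite V" "t \<le> card V"
  shows "card (level (cofamily V F) t) = card (level F (card V - t))"
  unfolding level_cofamily[OF assms]
  by (rule card_image, rule inj_on_subset[OF inj_on_Diff_Pow]) (use assms in \<open>auto simp: level_def\<close>)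

lemma sizes_cofamily:
  assumes "F \<subseteq> Pow V" "finite V"
  shows "sizes (cofamily V F) = (\<lambda>t. card V - t) ` sizes F"
  unfolding sizes_def cofamily_def image_image
  by (rule image_cong) (use assms in \<open>auto simp: card_Diff_subset finite_subset\<close>)

lemma diff_image_atLeastAtMost:
  fixes a b c :: nat
  assumes "a \<le> c" "b \<le> c"
  shows "(\<lambda>t. c - t) ` {a..b} = {c - b..c - a}"
proof
  show "{c - b..c - a} \<subseteq> (\<lambda>t. c - t) ` {a..b}"
  proof
    fix x assume "x \<in> {c - b..c - a}"
    hence "x = c - (c - x)" "c - x \<in> {a..b}" using assms by auto
    thus "x \<in> (\<lambda>t. c - t) ` {a..b}" by (rule image_eqI)
  qed
qed auto

lemma sizes_le:
  assumes "F \<subseteq> Pow V" "finite V"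
  shows "sizes F \<subseteq> {..card V}"
  using assms by (auto simp: sizes_def intro: card_mono)

lemma multiplicity_antichain_cofamily:
  assumes F: "F \<subseteq> Pow V" "finite V" and m: "multiplicity_antichain r F"
  shows "multiplicity_antichain r (cofamily V F)"
  unfolding multiplicity_antichain_def
proof (intro conjI ballI impI)
  fix A B assume AB: "A \<in> cofamily V F" "B \<in> cofamily V F" "A \<noteq> B"
  then obtain A' B' where *: "A = V - A'" "B = V - B'" "A' \<in> F" "B' \<in> F"
    by (auto simp: cofamily_def)
  show "\<not> A \<subseteq> B"
  proof
    assume "A \<subseteq> B"
    hence "B' \<subseteq> A'" using * F(1) by blast
    thus False using multiplicity_antichainD(1)[OF m] * AB(3) by blast
  qed
next
  fix t assume "t \<in> sizes (cofamily V F)"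
  then obtain s where s: "s \<in> sizes F" "t = card V - s" using sizes_cofamily[OF F] by auto
  have "s \<le> card V" using sizes_le[OF F] s by auto
  hence "card (level (cofamily V F) t) = card (level F s)"
    using card_level_cofamily[OF F, of t] s by simp
  thus "r \<le> card (level (cofamily V F) t)" using multiplicity_antichainD(2)[OF m s(1)] by simp
qed

section \<open>Upper bounds on the number of sizes\<close>

text \<open>Every other member avoids the points of the at least \<open>r\<close> singletons, so its
  size is at most \<open>card V - r\<close>. The empty set is excluded because it lies in a
  singleton.\<close>

lemma card_sizes_singletons:
  assumes F: "F \<subseteq> Pow V" "finite V" and m: "multiplicity_antichain r F"
    and r: "4 \<le> r" and n: "5 \<le> card V" and one: "1 \<in> sizes F"
  shows "card (sizes F) < card V - 3"
proof -
  define U where "U = {u. {u} \<in> F}"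
  have "level F 1 = (\<lambda>u. {u}) ` U" by (auto simp: level_def U_def card_1_singleton_iff)
  hence "card (level F 1) = card U" by (simp add: card_image)
  hence rU: "r \<le> card U" using multiplicity_antichainD(2)[OF m one] by simp
  have UV: "U \<subseteq> V" using F by (auto simp: U_def)
  have "t \<in> insert 1 {2..card V - r}" if t: "t \<in> sizes F" for t
  proof (cases "t = 1")
    case False
    obtain A where A: "A \<in> F" "card A = t" using t by (auto simp: sizes_def)
    have "u \<notin> A" if "u \<in> U" for u
      using multiplicity_antichainD(1)[OF m, of "{u}" A] that A False by (auto simp: U_def)
    hence "A \<subseteq> V - U" using A F by auto
    hence "card A \<le> card (V - U)" using F by (intro card_mono) auto
    also have "\<dots> = card V - card U" using UV F by (simp add: card_Diff_subset finite_subset)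
    also have "\<dots> \<le> card V - r" using rU by simp
    finally have "t \<le> card V - r" using A by simp
    moreover have "t \<noteq> 0"
    proof
      assume "t = 0"
      hence "A = {}" using A F by (auto simp: finite_subset)
      moreover obtain B where "B \<in> F" "card B = 1" using one by (auto simp: sizes_def)
      ultimately show False using multiplicity_antichainD(1)[OF m, of A B] A by auto
    qed
    ultimately show ?thesis using False by auto
  qed simp
  hence "sizes F \<subseteq> insert 1 {2..card V - r}" by blast
  hence "card (sizes F) \<le> card (insert 1 {2..card V - r})" by (intro card_mono) simp_all
  also have "\<dots> = Suc (card V - r - 1)" by simp
  \<comment> \<open>For \<open>card V > r\<close> the count is
    \<open>card V - r \<le> card V - 4\<close>. Otherwise truncation makes it 1, and
    \<open>5 \<le> card V\<close> is needed.\<close>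
  finally show ?thesis using r n by linarith
qed

text \<open>Size \<open>card V - 1\<close> is size 1 in the complementary family, which has equally
  many sizes. The levels 0 and \<open>card V\<close> hold at most one set each, too few for
  multiplicity \<open>r\<close>.\<close>

lemma sizes_subset_or_few:
  assumes F: "F \<subseteq> Pow V" "finite V" and m: "multiplicity_antichain r F"
    and r: "4 \<le> r" and n: "5 \<le> card V"
  shows "sizes F \<subseteq> {2..card V - 2} \<or> card (sizes F) < card V - 3"
proof (rule disjCI)
  assume not_few: "\<not> card (sizes F) < card V - 3"
  have no_1: "1 \<notin> sizes F" using card_sizes_singletons[OF F m r n] not_few by blast
  have no_co1: "card V - 1 \<notin> sizes F"
  proof
    assume "card V - 1 \<in> sizes F"
    moreover have "1 = card V - (card V - 1)" using n by simp
    ultimately have "1 \<in> sizes (cofamily V F)" unfolding sizes_cofamily[OF F] by blast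
    hence "card (sizes (cofamily V F)) < card V - 3"
      using card_sizes_singletons[OF cofamily_subset F(2)] multiplicity_antichain_cofamily[OF F m] r n
      by blast
    moreover have "inj_on (\<lambda>t. card V - t) (sizes F)"
      using sizes_le[OF F] by (intro inj_onI) (metis atMost_iff diff_diff_cancel subsetD)
    ultimately show False using not_few by (simp add: sizes_cofamily[OF F] card_image)
  qed
  have no_triv: "t \<notin> sizes F" if "level F t \<subseteq> {A}" for t A
  proof
    assume "t \<in> sizes F"
    hence "r \<le> card (level F t)" using multiplicity_antichainD(2)[OF m] by blast
    also have "\<dots> \<le> card {A}" using that by (intro card_mono) auto
    finally show False using r by simp
  qed
  have "level F 0 \<subseteq> {{}}" using F by (auto simp: level_def finite_subset)
  hence no_0: "0 \<notin> sizes F" by (rule no_triv)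
  have "A = V" if "A \<in> level F (card V)" for A
    using that F by (intro card_subset_eq) (auto simp: level_def)
  hence "level F (card V) \<subseteq> {V}" by blast
  hence no_n: "card V \<notin> sizes F" by (rule no_triv)
  show "sizes F \<subseteq> {2..card V - 2}"
  proof
    fix t assume t: "t \<in> sizes F"
    have "t \<noteq> 0" "t \<noteq> 1" "t \<noteq> card V - 1" "t \<noteq> card V" using t no_0 no_1 no_co1 no_n by metis+
    moreover have "t \<le> card V" using sizes_le[OF F] t by auto
    ultimately show "t \<in> {2..card V - 2}" by auto
  qed
qed

section \<open>The critical ground set of \<open>2 * r + 2\<close> points\<close>

text \<open>With \<open>x\<close> removed, the members in question are \<open>r\<close>-subsets of a
  set \<open>W\<close> of at most \<open>r + 1\<close> points. A second star, with centre
  \<open>y\<close> in \<open>W\<close>, turns out to contain every pair through \<open>y\<close>, so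
  that such an \<open>r\<close>-subset must miss \<open>y\<close> and can only be
  \<open>W - {y}\<close>.\<close>

lemma star_level_through_centre:
  fixes x :: 'a
  assumes F: "F \<subseteq> Pow V" "finite V" and m: "multiplicity_antichain r F"
    and r: "4 \<le> r" and n: "card V = 2 * r + 2" and sz: "sizes F = {2..2 * r}"
    and x2: "\<And>A. A \<in> level F 2 \<Longrightarrow> x \<in> A"
    and xco: "\<And>A. A \<in> level F (2 * r) \<Longrightarrow> x \<notin> A" and xV: "x \<in> V"
    and A1: "A1 \<in> level F (r + 1)" "x \<in> A1" and A2: "A2 \<in> level F (r + 1)" "x \<in> A2"
  shows "A1 = A2"
proof (rule ccontr)
  assume ne: "A1 \<noteq> A2"
  note anti = multiplicity_antichainD(1)[OF m]
  have lev: "r \<le> card (level F t)" if "2 \<le> t" "t \<le> 2 * r" for t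
    using multiplicity_antichainD(2)[OF m, of t] sz that by auto
  have fin: "finite A" if "A \<in> F" for A using that F by (auto simp: finite_subset)
  have sub: "A = B" if "A \<in> level F s" "B \<in> level F t" "A \<subseteq> B" for A B s t
    using that anti by (auto simp: level_def)

  \<comment> \<open>The leaves of the star formed by the members of size 2.\<close>
  define L where "L = {l. l \<noteq> x \<and> {x, l} \<in> F}"
  have "level F 2 \<subseteq> (\<lambda>l. {x, l}) ` L"
  proof
    fix A assume A: "A \<in> level F 2"
    hence "card A = 2" by (simp add: level_def)
    then obtain l where l: "l \<in> A" "l \<noteq> x" by (auto simp: card_2_iff)
    have "A = {x, l}" using card_2_subset_eq[OF \<open>card A = 2\<close> x2[OF A] l(1)] l by auto
    thus "A \<in> (\<lambda>l. {x, l}) ` L" using A l by (auto simp: L_def level_def)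
  qed
  moreover have LV: "L \<subseteq> V" using F by (auto simp: L_def)
  ultimately have "card (level F 2) \<le> card L"
    using F(2) by (meson finite_subset surj_card_le)
  hence rL: "r \<le> card L" using lev[of 2] r by simp

  \<comment> \<open>The leaves of the dual star: members of size \<open>2 * r\<close> miss
    \<open>x\<close>, so their complements are pairs \<open>{x, u}\<close>.\<close>
  define M where "M = {u \<in> V. u \<noteq> x \<and> V - {x, u} \<in> F}"
  have "level F (2 * r) \<subseteq> (\<lambda>u. V - {x, u}) ` M"
  proof
    fix A assume A: "A \<in> level F (2 * r)"
    hence AV: "A \<subseteq> V" "card A = 2 * r" using F by (auto simp: level_def)
    hence c2: "card (V - A) = 2" using F(2) n by (simp add: card_Diff_subset finite_subset)
    have xA: "x \<in> V - A" using xco[OF A] xV by simp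
    obtain u where u: "u \<in> V - A" "u \<noteq> x" using c2 by (auto simp: card_2_iff)
    have "V - A = {x, u}" using card_2_subset_eq[OF c2 xA u(1)] u by auto
    hence "A = V - {x, u}" using AV by blast
    thus "A \<in> (\<lambda>u. V - {x, u}) ` M" using A u by (auto simp: M_def level_def)
  qed
  moreover have MV: "M \<subseteq> V" by (auto simp: M_def)
  ultimately have "card (level F (2 * r)) \<le> card M"
    using F(2) by (meson finite_subset surj_card_le)
  hence rM: "r \<le> card M" using lev[of "2 * r"] r by simp

  define W where "W = V - L - {x}"
  have finW: "finite W" using F by (simp add: W_def)
  have xL: "x \<notin> L" by (simp add: L_def)
  have "card W = card V - card (insert x L)"
  proof -
    have "W = V - insert x L" by (auto simp: W_def)
    thus ?thesis using LV xV F(2) by (simp add: card_Diff_subset finite_subset)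
  qed
  \<comment> \<open>Of the \<open>2 * r + 2\<close> points, \<open>x\<close> and at least
    \<open>r\<close> leaves are removed.\<close>
  hence cW: "card W \<le> r + 1" using xL LV F(2) rL n by (simp add: finite_subset)
  have through: "A - {x} \<subseteq> W" if "A \<in> level F t" "3 \<le> t" "x \<in> A" for A t
  proof -
    have "l \<notin> A" if "l \<in> L" for l
    proof
      assume "l \<in> A"
      hence "{x, l} \<subseteq> A" using \<open>x \<in> A\<close> by simp
      moreover have "{x, l} \<in> level F 2" using that by (auto simp: L_def level_def)
      ultimately have "{x, l} = A" using sub \<open>A \<in> level F t\<close> by blast
      thus False using \<open>A \<in> level F t\<close> \<open>3 \<le> t\<close> that by (auto simp: level_def L_def)
    qed
    moreover have "A \<subseteq> V" using that F by (auto simp: level_def)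
    ultimately show ?thesis by (auto simp: W_def)
  qed
  \<comment> \<open>A member that misses both \<open>x\<close> and some \<open>u \<in> M\<close>
    would lie inside the larger member \<open>V - {x, u}\<close>.\<close>
  have avoid: "M \<subseteq> A" if "A \<in> level F t" "t < 2 * r" "x \<notin> A" for A t
  proof
    fix u assume u: "u \<in> M"
    show "u \<in> A"
    proof (rule ccontr)
      assume "u \<notin> A"
      hence "A \<subseteq> V - {x, u}" using that F by (auto simp: level_def)
      moreover have "V - {x, u} \<in> F" "A \<in> F" using u that by (auto simp: M_def level_def)
      ultimately have "A = V - {x, u}" using anti by blast
      moreover have "card (V - {x, u}) = 2 * r"
        using u xV n F(2) by (auto simp: M_def card_Diff_subset)
      ultimately show False using that by (simp add: level_def)
    qed
  qed

  have x3: "x \<in> A" if "A \<in> level F 3" for A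
  proof (rule ccontr)
    assume "x \<notin> A"
    hence "M \<subseteq> A" using avoid that r by auto
    hence "card M \<le> card A" using that fin by (intro card_mono) (auto simp: level_def)
    thus False using rM r that by (simp add: level_def)
  qed
  \<comment> \<open>An auxiliary member \<open>B\<close> of size \<open>r + 3 < 2 * r\<close>. It is
    too large to pass through \<open>x\<close>, as \<open>W\<close> has at most \<open>r + 1\<close>
    points, so it contains \<open>M\<close>. This excludes \<open>M\<close> itself as a member of
    size \<open>r\<close>, which is the only way such a member could miss \<open>x\<close>.\<close>
  have "level F (r + 3) \<noteq> {}" using lev[of "r + 3"] r by auto
  then obtain B where B: "B \<in> level F (r + 3)" by auto
  have "x \<notin> B"
  proof
    assume "x \<in> B"
    hence "card (B - {x}) \<le> card W" using through[OF B] finW by (intro card_mono) auto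
    thus False using B cW \<open>x \<in> B\<close> fin by (simp add: level_def)
  qed
  hence MB: "M \<subseteq> B" using avoid[OF B] r by simp
  have xr: "x \<in> A" if A: "A \<in> level F r" for A
  proof (rule ccontr)
    assume "x \<notin> A"
    hence "M \<subseteq> A" using avoid A r by auto
    hence "M = A" using A rM fin by (intro card_seteq) (auto simp: level_def)
    hence "A = B" using sub A B MB by blast
    thus False using A B by (simp add: level_def)
  qed

  have A1W: "A1 - {x} \<subseteq> W" "card (A1 - {x}) = r" and A2W: "A2 - {x} \<subseteq> W" "card (A2 - {x}) = r"
    using through[of _ "r + 1"] A1 A2 r fin by (auto simp: level_def)
  have "A1 - {x} \<noteq> A2 - {x}" using ne A1 A2 by blast
  \<comment> \<open>\<open>A1\<close> and \<open>A2\<close> leave two distinct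
    \<open>r\<close>-subsets of \<open>W\<close>, so \<open>W\<close> needs more than
    \<open>r\<close> points.\<close>
  have "card W \<noteq> r"
    using A1W A2W \<open>A1 - {x} \<noteq> A2 - {x}\<close> finW by (metis card_subset_eq)
  moreover have "r \<le> card W" using A1W finW by (metis card_mono)
  ultimately have cW: "card W = r + 1" using cW by simp

  \<comment> \<open>Both families consist of pairs in \<open>W\<close>: a member of size
    \<open>r\<close> has \<open>r - 1\<close> points in \<open>W\<close>, all but two. A pair of
    \<open>Q\<close> disjoint from one of \<open>E\<close> would put a member of size 3 inside one
    of size \<open>r\<close>, so the star lemma applies again.\<close>
  define Q where "Q = (\<lambda>A. A - {x}) ` level F 3"
  define E where "E = (\<lambda>A. W - A) ` level F r"
  have "inj_on (\<lambda>A. A - {x}) (level F 3)" using x3 by (intro inj_onI) blast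
  hence rQ: "r \<le> card Q" using lev[of 3] r by (simp add: Q_def card_image)
  have "inj_on (\<lambda>A. W - A) (level F r)"
  proof (rule inj_onI)
    fix A B assume *: "A \<in> level F r" "B \<in> level F r" "W - A = W - B"
    have "A - {x} \<subseteq> W" "B - {x} \<subseteq> W" "x \<in> A" "x \<in> B" using through xr * r by auto
    thus "A = B" using *(3) by blast
  qed
  hence rE: "r \<le> card E" using lev[of r] r by (simp add: E_def card_image)
  have Q2: "card C = 2" if "C \<in> Q" for C
    using that x3 fin by (auto simp: Q_def level_def)
  have E2: "card C = 2" if C: "C \<in> E" for C
  proof -
    obtain A where A: "A \<in> level F r" "C = W - A" using C by (auto simp: E_def)
    have xA: "x \<in> A" "A - {x} \<subseteq> W" using through[OF A(1)] xr[OF A(1)] r by auto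
    have "C = W - (A - {x})" using A by (auto simp: W_def)
    hence "card C = card W - card (A - {x})"
      using xA finite_subset[OF xA(2) finW] by (simp only: card_Diff_subset)
    thus ?thesis using A xA fin cW r by (simp add: level_def)
  qed
  have cross: "C \<inter> D \<noteq> {}" if C: "C \<in> Q" and D: "D \<in> E" for C D
  proof
    assume e: "C \<inter> D = {}"
    obtain A where A: "A \<in> level F 3" "C = A - {x}" using C by (auto simp: Q_def)
    obtain B where B: "B \<in> level F r" "D = W - B" using D by (auto simp: E_def)
    have "A - {x} \<subseteq> W" using through[OF A(1)] x3[OF A(1)] by simp
    hence "A \<subseteq> B" using e A B xr[OF B(1)] by blast
    hence "A = B" using sub A B by blast
    thus False using A B r by (simp add: level_def)
  qed
  have "\<exists>y. \<forall>C\<in>Q \<union> E. y \<in> C"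
    by (rule cross_intersecting_pairs_star[OF Q2 E2 order_trans[OF r rQ] order_trans[OF r rE] cross])
  then obtain y where y: "\<And>C. C \<in> Q \<Longrightarrow> y \<in> C" by blast
  have QW: "C \<subseteq> W" if "C \<in> Q" for C using that through[of _ 3] x3 by (auto simp: Q_def)
  have "Q \<noteq> {}" using rQ r by auto
  hence yW: "y \<in> W" using y QW by blast
  have Qsub: "Q \<subseteq> (\<lambda>z. {y, z}) ` (W - {y})"
  proof
    fix C assume C: "C \<in> Q"
    obtain z where z: "z \<in> C" "z \<noteq> y" using Q2[OF C] by (auto simp: card_2_iff)
    have "C = {y, z}" using card_2_subset_eq[OF Q2[OF C] y[OF C] z(1)] z by auto
    thus "C \<in> (\<lambda>z. {y, z}) ` (W - {y})" using z QW[OF C] by auto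
  qed
  \<comment> \<open>\<open>W\<close> has only \<open>r\<close> pairs through \<open>y\<close>, and
    \<open>Q\<close> has at least \<open>r\<close> members, so \<open>Q\<close> is the full
    star.\<close>
  have "card ((\<lambda>z. {y, z}) ` (W - {y})) \<le> card Q"
    using card_image_le[of "W - {y}" "\<lambda>z. {y, z}"] finW yW cW rQ by simp
  hence Qall: "Q = (\<lambda>z. {y, z}) ` (W - {y})" using Qsub finW by (intro card_seteq) auto
  have only: "A - {x} = W - {y}" if A: "A \<in> level F (r + 1)" "x \<in> A" for A
  proof -
    have AW: "A - {x} \<subseteq> W" "card (A - {x}) = r"
      using through[of _ "r + 1"] A r fin by (auto simp: level_def)
    have "y \<notin> A"
    proof
      assume yA: "y \<in> A"
      \<comment> \<open>Since \<open>A - {x}\<close> has \<open>r \<ge> 4\<close> points, there is a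
        further point \<open>z\<close>. The pair \<open>{y, z}\<close> is in \<open>Q\<close>, so
        \<open>{x, y, z}\<close> is a member properly inside \<open>A\<close>.\<close>
      have "\<not> A - {x} \<subseteq> {y}" using AW r card_mono[of "{y}" "A - {x}"] by auto
      then obtain z where z: "z \<in> A" "z \<noteq> x" "z \<noteq> y" by auto
      hence "{y, z} \<in> Q" using AW Qall by auto
      then obtain C where C: "C \<in> level F 3" "{y, z} = C - {x}" by (auto simp: Q_def)
      have "C - {x} \<subseteq> A" using yA z(1) by (simp flip: C(2))
      hence "C \<subseteq> A" using A(2) by blast
      hence "C = A" using sub C A by blast
      thus False using C A r by (simp add: level_def)
    qed
    hence "A - {x} \<subseteq> W - {y}" using AW by auto
    thus ?thesis using AW yW cW finW by (intro card_subset_eq) auto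
  qed
  show False using only[OF A1] only[OF A2] \<open>A1 - {x} \<noteq> A2 - {x}\<close> by simp
qed

text \<open>The middle level \<open>r + 1\<close> is mapped to itself by complementation. The
  previous lemma, applied to \<open>F\<close> and to its complementary family with the same centre
  \<open>x\<close>, leaves it at most two members.\<close>

lemma not_all_sizes:
  fixes F :: "'a set set"
  assumes F: "F \<subseteq> Pow V" "finite V" and m: "multiplicity_antichain r F"
    and r: "4 \<le> r" and n: "card V = 2 * r + 2"
  shows "sizes F \<noteq> {2..2 * r}"
proof
  assume sz: "sizes F = {2..2 * r}"
  let ?F' = "cofamily V F"
  note F' = cofamily_subset[of V F] F(2) and m' = multiplicity_antichain_cofamily[OF F m]
  have lev: "r \<le> card (level F t)" if "2 \<le> t" "t \<le> 2 * r" for t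
    using multiplicity_antichainD(2)[OF m, of t] sz that by auto
  have sz': "sizes ?F' = {2..2 * r}"
  proof -
    have "(\<lambda>t. card V - t) ` {2..2 * r} = {2..2 * r}"
      using diff_image_atLeastAtMost[of 2 "2 * r + 2" "2 * r"] n by simp
    thus ?thesis using sizes_cofamily[OF F] sz by simp
  qed
  have lev': "level ?F' t = (\<lambda>A. V - A) ` level F (2 * r + 2 - t)" if "t \<le> 2 * r + 2" for t
    using level_cofamily[OF F, of t] that n by simp
  have c': "r \<le> card (level ?F' 2)" using multiplicity_antichainD(2)[OF m', of 2] sz' r by auto
  \<comment> \<open>A pair disjoint from the complement of a set of size \<open>2 * r\<close> would
    be contained in that set.\<close>
  have cross: "A \<inter> B \<noteq> {}" if A: "A \<in> level F 2" and B: "B \<in> level ?F' 2" for A B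
  proof
    assume e: "A \<inter> B = {}"
    obtain C where C: "B = V - C" "C \<in> level F (2 * r)" using B lev'[of 2] by auto
    have "A \<subseteq> C" using e C A F by (auto simp: level_def)
    hence "A = C" using multiplicity_antichainD(1)[OF m] C A by (auto simp: level_def)
    thus False using C A r by (simp add: level_def)
  qed
  have c: "r \<le> card (level F 2)" using lev[of 2] r by simp
  have pair: "card A = 2" if "A \<in> level G 2" for A :: "'a set" and G
    using that by (simp add: level_def)
  have "\<exists>x. \<forall>A\<in>level F 2 \<union> level ?F' 2. x \<in> A"
    by (rule cross_intersecting_pairs_star
        [OF pair pair order_trans[OF r c] order_trans[OF r c'] cross])
  then obtain x where x: "\<And>A. A \<in> level F 2 \<Longrightarrow> x \<in> A" "\<And>A. A \<in> level ?F' 2 \<Longrightarrow> x \<in> A"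
    by blast
  have xco: "x \<notin> A" if "A \<in> level F (2 * r)" for A
    using x(2)[of "V - A"] lev'[of 2] that by auto
  have xco': "x \<notin> A" if A: "A \<in> level ?F' (2 * r)" for A
    using x(1) lev'[of "2 * r"] A by auto
  have "level F 2 \<noteq> {}" using lev[of 2] r by auto
  then obtain A where "A \<in> level F 2" by auto
  hence xV: "x \<in> V" using x(1) F by (auto simp: level_def)
  note uniq = star_level_through_centre[OF F m r n sz x(1) xco xV]
  note uniq' = star_level_through_centre[OF F' m' r n sz' x(2) xco' xV]
  define P where "P = {A \<in> level F (r + 1). x \<in> A}"
  define N where "N = {A \<in> level F (r + 1). x \<notin> A}"
  have finF: "finite F" using F by (meson finite_Pow_iff finite_subset)
  have "card P \<le> 1" using uniq finF by (intro card_le_Suc0_iff_eq[THEN iffD2, folded One_nat_def])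
      (auto simp: P_def level_def)
  moreover have "card N \<le> 1"
  proof -
    \<comment> \<open>Complements of members of \<open>N\<close> pass through \<open>x\<close> and
      again have \<open>r + 1\<close> points.\<close>
    have "A = B" if A: "A \<in> N" and B: "B \<in> N" for A B
    proof -
      have "V - A = V - B"
        using lev'[of "r + 1"] A B xV by (intro uniq') (auto simp: N_def)
      thus ?thesis using A B F by (auto simp: N_def level_def double_diff)
    qed
    moreover have "finite N" using finF by (simp add: N_def level_def)
    ultimately show ?thesis by (simp add: card_le_Suc0_iff_eq)
  qed
  moreover have "level F (r + 1) = P \<union> N" by (auto simp: P_def N_def)
  hence "card (level F (r + 1)) \<le> card P + card N" by (simp add: card_Un_le)
  ultimately show False using lev[of "r + 1"] r by simp
qed

section \<open>Construction of antichains with all intermediate sizes for large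
  \<open>n\<close>\<close>

text \<open>The two base-\<open>q\<close> digits of \<open>k\<close> are marked by one point each,
  in two disjoint blocks of \<open>q\<close> points beyond \<open>h\<close>. Padding stays within
  \<open>{1..h}\<close>, so an inclusion forces both digits to agree, whatever the lengths of the
  padding.\<close>

lemma padded_pair_inj:
  fixes k k' q h t t' :: nat
  assumes "0 < q" "k < q * q" "k' < q * q"
    and sub: "{1..t - 2} \<union> {h + 1 + k div q, h + q + 1 + k mod q}
      \<subseteq> {1..t' - 2} \<union> {h + 1 + k' div q, h + q + 1 + k' mod q}" and "t' \<le> h"
  shows "k = k'"
proof -
  have d: "k div q < q" "k' div q < q" using assms by (auto simp: less_mult_imp_div_less)
  have "h + 1 + k div q \<in> {1..t' - 2} \<union> {h + 1 + k' div q, h + q + 1 + k' mod q}" using sub by blast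
  hence "k div q = k' div q" using d \<open>t' \<le> h\<close> by auto
  moreover have "h + q + 1 + k mod q \<in> {1..t' - 2} \<union> {h + 1 + k' div q, h + q + 1 + k' mod q}"
    using sub by blast
  hence "k mod q = k' mod q" using d \<open>t' \<le> h\<close> by auto
  ultimately show ?thesis by (metis div_mult_mod_eq)
qed

lemma small_sizes_antichain:
  fixes r h q N :: nat
  assumes r: "0 < r" and h: "1 \<le> h" and q: "(h + 1) * r \<le> q * q" and N: "h + 2 * q + r \<le> N"
  obtains F where "F \<subseteq> Pow {1..N}" "multiplicity_antichain r F" "sizes F = {1..h}"
proof -
  \<comment> \<open>Layout of the ground set: padding in \<open>{1..h}\<close>, two blocks of
    \<open>q\<close> points for the digits, then \<open>r\<close> points for the singletons.
    \<open>T t s\<close> has \<open>t - 2\<close> padding points and the pair \<open>D\<close>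
    coding the index \<open>t * r + s\<close>. Since \<open>s < r\<close>, the index determines
    \<open>t\<close> and \<open>s\<close>, so distinct sets \<open>T t s\<close> are
    incomparable.\<close>
  define S where "S s = {h + 2 * q + 1 + s}" for s
  define D where "D k = {h + 1 + k div q, h + q + 1 + k mod q}" for k
  define T where "T t s = {1..t - 2} \<union> D (t * r + s)" for t s
  define F where "F = S ` {..<r} \<union> {T t s | t s. 2 \<le> t \<and> t \<le> h \<and> s < r}"
  have q0: "0 < q" using q r by (cases q) auto
  have key: "t * r + s < q * q" if "t \<le> h" "s < r" for t s
  proof -
    have "t * r + s < t * r + r" using that by simp
    also have "\<dots> \<le> (h + 1) * r" using that by (simp add: add_mult_distrib)
    finally show ?thesis using q by simp
  qed
  have Dsub: "D k \<subseteq> {h + 1..h + 2 * q}" "card (D k) = 2" if "k < q * q" for k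
  proof -
    have "k div q < q" using that by (rule less_mult_imp_div_less)
    moreover have "k mod q < q" using q0 by (rule mod_less_divisor)
    ultimately show "D k \<subseteq> {h + 1..h + 2 * q}" "card (D k) = 2" by (auto simp: D_def Suc_le_eq)
  qed
  have Tsub: "T t s \<subseteq> {1..h + 2 * q}" if "t \<le> h" "s < r" for t s
    using Dsub(1)[OF key[OF that]] that by (auto simp: T_def)
  have cT: "card (T t s) = t" if "2 \<le> t" "t \<le> h" "s < r" for t s
  proof -
    have "card (T t s) = card {1..t - 2} + card (D (t * r + s))"
      unfolding T_def
      by (rule card_Un_disjoint) (use Dsub(1)[OF key[OF that(2,3)]] that in \<open>auto simp: D_def\<close>)
    thus ?thesis using Dsub(2)[OF key[OF that(2,3)]] that by simp
  qed
  have Tinj: "t = t' \<and> s = s'" if "T t s \<subseteq> T t' s'" "t \<le> h" "t' \<le> h" "s < r" "s' < r" for t t' s s'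
  proof -
    have "t * r + s = t' * r + s'"
      using padded_pair_inj[OF q0 key key] that unfolding T_def D_def by blast
    hence "(t * r + s) div r = (t' * r + s') div r" "(t * r + s) mod r = (t' * r + s') mod r" by auto
    thus ?thesis using that by auto
  qed
  have cS: "card (S s) = 1" for s by (simp add: S_def)
  have FN: "F \<subseteq> Pow {1..N}"
  proof
    fix A assume "A \<in> F"
    then consider s where "s < r" "A = S s" | t s where "t \<le> h" "s < r" "A = T t s"
      by (auto simp: F_def)
    thus "A \<in> Pow {1..N}" by cases (use Tsub N in \<open>fastforce simp: S_def\<close>)+
  qed
  have ST: "\<not> S s \<subseteq> T t s'" if "t \<le> h" "s' < r" for s t s'
    using Tsub[OF that] by (auto simp: S_def)
  have TS: "\<not> T t s \<subseteq> S s'" if "2 \<le> t" "t \<le> h" "s < r" for s t s'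
  proof
    assume "T t s \<subseteq> S s'"
    hence "card (T t s) \<le> card (S s')" by (intro card_mono) (auto simp: S_def)
    thus False using cT[OF that] cS that by simp
  qed
  have anti: "A = B" if "A \<in> F" "B \<in> F" "A \<subseteq> B" for A B
    using that ST TS Tinj unfolding F_def by (auto simp: S_def) blast+
  have sz: "sizes F = {1..h}"
  proof
    show "sizes F \<subseteq> {1..h}" using h cT cS by (auto simp: sizes_def F_def)
    show "{1..h} \<subseteq> sizes F"
    proof
      fix t assume t: "t \<in> {1..h}"
      show "t \<in> sizes F"
      proof (cases "t = 1")
        case True
        thus ?thesis using cS[of 0] r unfolding sizes_def F_def by force
      next
        case False
        hence "2 \<le> t" "t \<le> h" using t by auto
        hence "T t 0 \<in> F" "card (T t 0) = t" using cT r by (auto simp: F_def)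
        thus ?thesis unfolding sizes_def by force
      qed
    qed
  qed
  have finF: "finite F" using FN by (meson finite_Pow_iff finite_atLeastAtMost finite_subset)
  have many: "r \<le> card (level F t)" if "inj_on f {..<r}" "f ` {..<r} \<subseteq> level F t" for f t
    using card_inj_on_le[OF that] finF by (simp add: level_def)
  have "r \<le> card (level F t)" if t: "t \<in> sizes F" for t
  proof (cases "t = 1")
    case True
    show ?thesis using cS unfolding True by (intro many[of S]) (auto simp: F_def level_def S_def inj_on_def)
  next
    case False
    hence t: "2 \<le> t" "t \<le> h" using t sz by auto
    show ?thesis
    proof (rule many[of "T t"])
      show "inj_on (T t) {..<r}" using Tinj t by (intro inj_onI) (metis lessThan_iff order_refl)
      show "T t ` {..<r} \<subseteq> level F t" using t cT by (auto simp: F_def level_def)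
    qed
  qed
  hence "multiplicity_antichain r F" unfolding multiplicity_antichain_def using anti by blast
  with FN sz that show ?thesis by blast
qed

text \<open>The lower half \<open>X\<close> has sizes \<open>{2..a + 1}\<close> and its members
  contain \<open>n\<close>. The upper half \<open>Y\<close> has sizes \<open>{a + 2..n - 2}\<close>
  and its members miss \<open>n\<close>. The point \<open>n\<close> prevents inclusions of
  \<open>X\<close> in \<open>Y\<close>, and size prevents the converse.\<close>

lemma glue_antichains:
  fixes a b n r :: nat
  assumes n: "a + b + 3 = n"
    and A: "\<A> \<subseteq> Pow {1..n - 1}" "multiplicity_antichain r \<A>" "sizes \<A> = {1..a}"
    and B: "\<B> \<subseteq> Pow {1..n - 1}" "multiplicity_antichain r \<B>" "sizes \<B> = {1..b}"
  obtains F where "F \<subseteq> Pow {1..n}" "multiplicity_antichain r F" "sizes F = {2..n - 2}"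
proof -
  define X where "X = insert n ` \<A>"
  define Y where "Y = cofamily {1..n - 1} \<B>"
  have nA: "n \<notin> C" "finite C" if "C \<in> \<A>" for C
  proof -
    have "C \<subseteq> {1..n - 1}" using that A(1) by blast
    thus "n \<notin> C" "finite C" using n by (auto simp: finite_subset)
  qed
  have YV: "Y \<subseteq> Pow {1..n - 1}" unfolding Y_def by (rule cofamily_subset)
  have mY: "multiplicity_antichain r Y"
    unfolding Y_def by (rule multiplicity_antichain_cofamily[OF B(1) _ B(2)]) simp
  have "sizes Y = (\<lambda>t. n - 1 - t) ` {1..b}"
    unfolding Y_def using sizes_cofamily[OF B(1)] B(3) by simp
  also have "\<dots> = {a + 2..n - 2}"
    using diff_image_atLeastAtMost[of 1 "n - 1" b] n by auto
  finally have szY: "sizes Y = {a + 2..n - 2}" .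
  have "sizes X = Suc ` sizes \<A>"
    unfolding sizes_def X_def image_image using nA by (intro image_cong) auto
  hence szX: "sizes X = {2..a + 1}" using A(3) by (simp add: image_Suc_atLeastAtMost)
  have levX: "level X (Suc t) = insert n ` level \<A> t" for t
    using nA by (auto simp: level_def X_def)
  have injX: "inj_on (insert n) \<A>" using nA by (intro inj_onI) (metis insert_ident)
  define F where "F = X \<union> Y"
  have "sizes F = sizes X \<union> sizes Y" by (simp add: sizes_def F_def image_Un)
  also have "\<dots> = {2..n - 2}" using szX szY n by auto
  finally have sz: "sizes F = {2..n - 2}" .
  have FV: "F \<subseteq> Pow {1..n}" using A(1) YV n by (fastforce simp: F_def X_def)
  have fin: "finite F" using FV by (meson finite_Pow_iff finite_atLeastAtMost finite_subset)
  have "r \<le> card (level F t)" if t: "t \<in> sizes F" for t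
  proof -
    have "\<exists>Z\<subseteq>F. r \<le> card (level Z t)"
    proof (cases "t \<in> sizes X")
      case True
      then obtain s where s: "t = Suc s" "s \<in> sizes \<A>" using szX A(3) by (cases t) auto
      have "card (level X t) = card (level \<A> s)"
        unfolding s(1) levX by (rule card_image, rule inj_on_subset[OF injX]) (auto simp: level_def)
      hence "r \<le> card (level X t)" using multiplicity_antichainD(2)[OF A(2) s(2)] by simp
      thus ?thesis by (intro exI[of _ X]) (simp add: F_def)
    next
      case False
      hence "t \<in> sizes Y" using t by (auto simp: sizes_def F_def)
      hence "r \<le> card (level Y t)" by (rule multiplicity_antichainD(2)[OF mY])
      thus ?thesis by (intro exI[of _ Y]) (simp add: F_def)
    qed
    then obtain Z where "Z \<subseteq> F" "r \<le> card (level Z t)" by blast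
    moreover have "card (level Z t) \<le> card (level F t)"
      using \<open>Z \<subseteq> F\<close> fin by (intro card_mono) (auto simp: level_def)
    ultimately show ?thesis by simp
  qed
  moreover have "C = D" if CD: "C \<in> F" "D \<in> F" "C \<subseteq> D" for C D
  proof -
    consider "C \<in> X" "D \<in> X" | "C \<in> X" "D \<in> Y" | "C \<in> Y" "D \<in> X" | "C \<in> Y" "D \<in> Y"
      using CD by (auto simp: F_def)
    thus ?thesis
    proof cases
      case 1
      then obtain C' D' where *: "C = insert n C'" "D = insert n D'" "C' \<in> \<A>" "D' \<in> \<A>"
        by (auto simp: X_def)
      hence "C' \<subseteq> D'" using that(3) nA by blast
      thus ?thesis using multiplicity_antichainD(1)[OF A(2)] * by blast
    next
      case 2
      hence "n \<in> D" "D \<subseteq> {1..n - 1}" using that(3) YV by (auto simp: X_def)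
      hence "n \<in> {1..n - 1}" by blast
      thus ?thesis using n by simp
    next
      case 3
      have "card C \<le> card D" using that FV by (intro card_mono) (auto intro: finite_subset)
      moreover have "card C \<in> sizes Y" "card D \<in> sizes X" using 3 by (auto simp: sizes_def)
      ultimately show ?thesis using szX szY by auto
    next
      case 4
      thus ?thesis using multiplicity_antichainD(1)[OF mY] that by blast
    qed
  qed
  ultimately have "multiplicity_antichain r F" unfolding multiplicity_antichain_def by blast
  with FV sz that show ?thesis by blast
qed

section \<open>Values of \<open>g\<close> and the bound on \<open>n0\<close>\<close>

lemma g_set_finite:
  "finite {card (sizes F) | F. F \<subseteq> Pow {1..n::nat} \<and> multiplicity_antichain r F}"
proof -
  have "finite {F. F \<subseteq> Pow {1..n::nat} \<and> multiplicity_antichain r F}"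
    by (rule finite_subset[of _ "Pow (Pow {1..n})"]) auto
  thus ?thesis by (simp add: setcompr_eq_image)
qed

lemma g_attained:
  obtains F where "F \<subseteq> Pow {1..n}" "multiplicity_antichain r F" "card (sizes F) = g n r"
proof -
  have "multiplicity_antichain r ({} :: nat set set)"
    by (simp add: multiplicity_antichain_def sizes_def)
  hence "{card (sizes F) | F. F \<subseteq> Pow {1..n} \<and> multiplicity_antichain r F} \<noteq> {}" by blast
  from Max_in[OF g_set_finite this] that show ?thesis unfolding g_def by auto
qed

lemma g_ge:
  assumes "F \<subseteq> Pow {1..n}" "multiplicity_antichain r F"
  shows "card (sizes F) \<le> g n r"
  unfolding g_def by (rule Max_ge[OF g_set_finite]) (use assms in blast)

lemma g_le:
  assumes "4 \<le> r" "5 \<le> n"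
  shows "g n r \<le> n - 3"
proof -
  obtain F where F: "F \<subseteq> Pow {1..n}" "multiplicity_antichain r F" "card (sizes F) = g n r"
    by (rule g_attained)
  have "card (sizes F) \<le> n - 3" if "sizes F \<subseteq> {2..n - 2}"
    using card_mono[OF _ that] by simp
  thus ?thesis using sizes_subset_or_few[OF F(1) _ F(2) assms(1)] assms F(3) by auto
qed

lemma g_eq_large:
  assumes r: "4 \<le> r" and n: "200 * r \<le> n"
  shows "g n r = n - 3"
proof -
  \<comment> \<open>The sizes are split evenly. Taking \<open>q\<close> near \<open>a / 4\<close>
    leaves room for \<open>a + 2 * q + r\<close> points below \<open>n\<close>, while
    \<open>(a + 1) * r \<le> q * q\<close> follows from \<open>q \<ge> 5 * r\<close>. The factor 200
    is a generous choice that ensures both.\<close>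
  define a where "a = (n - 2) div 2"
  define b where "b = n - 3 - a"
  have ab: "a + b + 3 = n" "b \<le> a" "1 \<le> b" "1 \<le> a" using r n by (auto simp: a_def b_def)
  define q where "q = a div 4"
  have "2 * a + 2 \<le> n" "99 * r \<le> a" using r n by (auto simp: a_def)
  have q: "24 * r \<le> q" "4 * q \<le> a" "a + 1 \<le> 5 * q" using \<open>99 * r \<le> a\<close> r by (auto simp: q_def)
  have "(a + 1) * r \<le> (5 * q) * r" using q(3) by (rule mult_le_mono1)
  also have "\<dots> = q * (5 * r)" by simp
  also have "\<dots> \<le> q * q" using q by (intro mult_le_mono2) simp
  finally have qa: "(a + 1) * r \<le> q * q" .
  have "(b + 1) * r \<le> (a + 1) * r" using ab by simp
  hence qb: "(b + 1) * r \<le> q * q" using qa by (rule order_trans)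
  have N: "a + 2 * q + r \<le> n - 1" "b + 2 * q + r \<le> n - 1"
    using q ab \<open>2 * a + 2 \<le> n\<close> by auto
  have r0: "0 < r" using r by simp
  obtain \<A> where A: "\<A> \<subseteq> Pow {1..n - 1}" "multiplicity_antichain r \<A>" "sizes \<A> = {1..a}"
    by (rule small_sizes_antichain[OF r0 ab(4) qa N(1)])
  obtain \<B> where B: "\<B> \<subseteq> Pow {1..n - 1}" "multiplicity_antichain r \<B>" "sizes \<B> = {1..b}"
    by (rule small_sizes_antichain[OF r0 ab(3) qb N(2)])
  obtain F where F: "F \<subseteq> Pow {1..n}" "multiplicity_antichain r F" "sizes F = {2..n - 2}"
    by (rule glue_antichains[OF ab(1) A B])
  have "n - 3 \<le> g n r" using g_ge[OF F(1,2)] F(3) by simp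
  moreover have "g n r \<le> n - 3" using g_le[OF r] n r by simp
  ultimately show ?thesis by simp
qed

lemma g_ne_critical:
  assumes r: "4 \<le> r"
  shows "g (2 * r + 2) r \<noteq> 2 * r - 1"
proof
  assume eq: "g (2 * r + 2) r = 2 * r - 1"
  obtain F where F: "F \<subseteq> Pow {1..2 * r + 2}" "multiplicity_antichain r F"
    "card (sizes F) = g (2 * r + 2) r" by (rule g_attained)
  have "sizes F \<subseteq> {2..2 * r}"
    using sizes_subset_or_few[OF F(1) _ F(2) r] F(3) eq r by auto
  \<comment> \<open>The interval has exactly \<open>2 * r - 1\<close> elements, so equality in the
    count leaves no size out.\<close>
  hence "sizes F = {2..2 * r}" using F(3) eq r by (intro card_subset_eq) auto
  thus False using not_all_sizes[OF F(1) _ F(2) r] by simp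
qed

theorem theorem1p4:
  fixes r :: nat
  assumes "r \<ge> 4"
  shows "n0 r \<ge> 2 * r + 2"
proof (rule ccontr)
  assume small: "\<not> n0 r \<ge> 2 * r + 2"
  \<comment> \<open>A witness is required before \<open>LEAST\<close> can be used: only then does
    \<open>n0 r\<close> itself have the defining property, which can be evaluated at
    \<open>2 * r + 2\<close>.\<close>
  have "\<forall>n>200 * r. int (g n r) = int n - 3"
    using g_eq_large[OF assms] assms by auto
  hence "\<exists>m. \<forall>n>m. int (g n r) = int n - 3" by blast
  hence "\<forall>n>n0 r. int (g n r) = int n - 3" unfolding n0_def by (rule LeastI_ex)
  hence "int (g (2 * r + 2) r) = int (2 * r + 2) - 3" using small by simp
  hence "g (2 * r + 2) r = 2 * r - 1" using assms by linarith
  thus False using g_ne_critical[OF assms] by simp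
qed

end
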